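(* Let $1\le p<\infty$. For every fixed $k\in\mathbb N_0$ define the sequence $b^{(k)}=(b^{(k)}_n)_{n\in\mathbb N_0}$ by $$b^{(k)}_n=\begin{cases}0,& n<k,\\[2pt] \dfrac{\lambda_k f_{n+1}^2}{(\lambda_k-\lambda_{k-1})f_kf_{k+1}},& n=k,\\[8pt] \dfrac{\lambda_k f_{n+1}^2}{(\lambda_k-\lambda_{k-1})f_kf_{k+1}}-\dfrac{\lambda_k f_{n+1}^2}{(\lambda_{k+1}-\lambda_k)f_{k+1}f_{k+2}},& n>k.\end{cases}$$ Then: (i) The space $\ell_\infty^{\lambda}(\widehat F)$ has no Schauder basis. (ii) The sequence $(b^{(k)})_{k\in\mathbb N_0}$ is a Schauder basis for $\ell_p^{\lambda}(\widehat F)$, and every $x\in\ell_p^{\lambda}(\widehat F)$ has a unique representation of the form $x=\sum_{k}\alpha_kb^{(k)}$, where $\alpha_k=E_k(x)$ for all $k\in\mathbb N_0$.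
   Context: $\mathbb N_0=\{0,1,2,\dots\}$; $\omega$ is the space of all real sequences $x=(x_k)_{k\in\mathbb N_0}$. Fibonacci numbers: $f_0=f_1=1$, $f_n=f_{n-1}+f_{n-2}$ for $n\ge 2$. $\lambda=(\lambda_k)_{k\in\mathbb N_0}$ is a fixed strictly increasing sequence of positive reals with $\lambda_k\to\infty$. Terms with negative subscript are $0$ (so $\lambda_{-1}=0$, $x_{-1}=0$). For $x\in\omega$ put $$E_n(x)=\frac1{\lambda_n}\sum_{k=0}^n(\lambda_k-\lambda_{k-1})\Big(\frac{f_k}{f_{k+1}}x_k-\frac{f_{k+1}}{f_k}x_{k-1}\Big),\qquad Ex=(E_n(x))_{n\in\mathbb N_0}.$$ $\ell_p^{\lambda}(\widehat F)=\{x\in\omega: Ex\in\ell_p\}$ with norm $\|Ex\|_p$, and $\ell_\infty^{\lambda}(\widehat F)=\{x\in\omega: Ex\in\ell_\infty\}$ with norm $\|Ex\|_\infty$. A Schauder basis of a normed space $X$ is a sequence $(b_n)$ in $X$ such that every $x\in X$ has a unique scalar sequence $(\alpha_n)$ with $\|x-\sum_{n=0}^m\alpha_nb_n\|\to0$ as $m\to\infty$. *)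

theory Defs
  imports "HOL-Analysis.Analysis" "HOL-Number_Theory.Fib"
begin

text \<open>The library's \<^term>\<open>fib\<close> starts with \<open>fib 0 = 0\<close>; here the indexing is \<open>f\<^sub>0 = f\<^sub>1 = 1\<close>.\<close>

definition fibo :: "nat \<Rightarrow> real" where
  "fibo n = real (fib (Suc n))"

text \<open>The term with index \<open>k - 1\<close>, which is \<open>0\<close> for \<open>k = 0\<close>.\<close>

definition prev :: "(nat \<Rightarrow> real) \<Rightarrow> nat \<Rightarrow> real" where
  "prev x k = (case k of 0 \<Rightarrow> 0 | Suc j \<Rightarrow> x j)"

definition E :: "(nat \<Rightarrow> real) \<Rightarrow> (nat \<Rightarrow> real) \<Rightarrow> nat \<Rightarrow> real" where
  "E lam x n = 1 / lam n *
     (\<Sum>k=0..n. (lam k - prev lam k) *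
        (fibo k / fibo (k + 1) * x k - fibo (k + 1) / fibo k * prev x k))"

definition ell :: "real \<Rightarrow> (nat \<Rightarrow> real) set" where
  "ell p = {x. summable (\<lambda>k. \<bar>x k\<bar> powr p)}"

definition ell_norm :: "real \<Rightarrow> (nat \<Rightarrow> real) \<Rightarrow> real" where
  "ell_norm p x = (\<Sum>k. \<bar>x k\<bar> powr p) powr (1 / p)"

definition ell_inf :: "(nat \<Rightarrow> real) set" where
  "ell_inf = {x. bounded (range x)}"

definition ell_inf_norm :: "(nat \<Rightarrow> real) \<Rightarrow> real" where
  "ell_inf_norm x = (SUP k. \<bar>x k\<bar>)"

definition ellF :: "(nat \<Rightarrow> real) \<Rightarrow> real \<Rightarrow> (nat \<Rightarrow> real) set" where
  "ellF lam p = {x. E lam x \<in> ell p}"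

definition ellF_norm :: "(nat \<Rightarrow> real) \<Rightarrow> real \<Rightarrow> (nat \<Rightarrow> real) \<Rightarrow> real" where
  "ellF_norm lam p x = ell_norm p (E lam x)"

definition ellF_inf :: "(nat \<Rightarrow> real) \<Rightarrow> (nat \<Rightarrow> real) set" where
  "ellF_inf lam = {x. E lam x \<in> ell_inf}"

definition ellF_inf_norm :: "(nat \<Rightarrow> real) \<Rightarrow> (nat \<Rightarrow> real) \<Rightarrow> real" where
  "ellF_inf_norm lam x = ell_inf_norm (E lam x)"

text \<open>\<open>x = \<Sum>\<^sub>k \<alpha>\<^sub>k b\<^sub>k\<close>, with convergence of the partial sums in the norm \<open>N\<close> of a space of
  sequences. Vector operations on sequences are written out pointwise, since the function type is
  not an instance of \<^class>\<open>real_vector\<close>.\<close>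

definition expands ::
  "((nat \<Rightarrow> real) \<Rightarrow> real) \<Rightarrow> (nat \<Rightarrow> nat \<Rightarrow> real) \<Rightarrow> (nat \<Rightarrow> real) \<Rightarrow> (nat \<Rightarrow> real) \<Rightarrow> bool" where
  "expands N b x \<alpha> \<longleftrightarrow> (\<lambda>m. N (\<lambda>j. x j - (\<Sum>n=0..m. \<alpha> n * b n j))) \<longlonglongrightarrow> 0"

text \<open>Schauder basis \<open>b\<close> of the sequence space with carrier \<open>X\<close> and norm \<open>N\<close>.\<close>

definition schauder_basis ::
  "(nat \<Rightarrow> real) set \<Rightarrow> ((nat \<Rightarrow> real) \<Rightarrow> real) \<Rightarrow> (nat \<Rightarrow> nat \<Rightarrow> real) \<Rightarrow> bool" where
  "schauder_basis X N b \<longleftrightarrow> (\<forall>n. b n \<in> X) \<and> (\<forall>x\<in>X. \<exists>!\<alpha>. expands N b x \<alpha>)"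

definition basis_seq :: "(nat \<Rightarrow> real) \<Rightarrow> nat \<Rightarrow> nat \<Rightarrow> real" where
  "basis_seq lam k n =
     (if n < k then 0
      else if n = k then
        lam k * (fibo (n + 1))\<^sup>2 / ((lam k - prev lam k) * fibo k * fibo (k + 1))
      else
        lam k * (fibo (n + 1))\<^sup>2 / ((lam k - prev lam k) * fibo k * fibo (k + 1))
        - lam k * (fibo (n + 1))\<^sup>2 / ((lam (k + 1) - lam k) * fibo (k + 1) * fibo (k + 2)))"

end

theory Submission
  imports Defs
begin

text \<open>The operator \<^term>\<open>E lam\<close> is linear and maps onto the space of all sequences: it is a weighted
  mean composed with a two-term difference operator, and both invert explicitly. The sequence
  \<open>b\<^sup>(\<^sup>k\<^sup>)\<close> is the preimage of the \<open>k\<close>-th unit vector, so (ii) reduces to the unit vectors being a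
  basis of \<open>\<ell>\<^sub>p\<close> and (i) to \<open>\<ell>\<^sub>\<infinity>\<close> having no countable set with dense span. The latter
  is a diagonal argument against the countably many rational combinations.\<close>

section \<open>Linearity of \<open>E lam\<close>, a right inverse, and the preimages of the unit
  vectors\<close>

lemma fibo_pos [simp]: "0 < fibo n"
  by (simp add: fibo_def fib_neq_0_nat del: fib.simps)

lemma prev_Suc [simp]: "prev x (Suc k) = x k"
  by (simp add: prev_def)

lemma prev_0 [simp]: "prev x 0 = 0"
  by (simp add: prev_def)

lemma prev_lincomb: "prev (\<lambda>j. x j + c * y j) k = prev x k + c * prev y k"
  by (cases k) auto

lemma E_lincomb: "E lam (\<lambda>j. x j + c * y j) n = E lam x n + c * E lam y n"
  unfolding E_def prev_lincomb
  by (simp add: algebra_simps sum.distrib sum_distrib_left sum_subtractf)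

lemma E_diff_sum:
  fixes m :: nat
  shows "E lam (\<lambda>j. x j - (\<Sum>n=0..m. \<alpha> n * b n j)) i = E lam x i - (\<Sum>n=0..m. \<alpha> n * E lam (b n) i)"
proof (induction m)
  case 0
  show ?case using E_lincomb[of lam x "- \<alpha> 0" "b 0" i] by simp
next
  case (Suc m)
  have "(\<lambda>j. x j - (\<Sum>n=0..Suc m. \<alpha> n * b n j)) =
      (\<lambda>j. (x j - (\<Sum>n=0..m. \<alpha> n * b n j)) + (- \<alpha> (Suc m)) * b (Suc m) j)"
    by (simp add: algebra_simps)
  then show ?case
    using E_lincomb[of lam "\<lambda>j. x j - (\<Sum>n=0..m. \<alpha> n * b n j)" "- \<alpha> (Suc m)" "b (Suc m)" i] Suc
    by simp
qed

text \<open>The formula comes from solving \<open>E lam x = z\<close>. Differencing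
  \<open>lam n * z n\<close> in \<open>n\<close> isolates the single summands of \<open>E\<close>;
  substituting x_k = f_{k+1}^2 y_k turns the Fibonacci bracket into f_k f_{k+1} (y_k - y_{k-1}), and
  summing these increments recovers y.\<close>

definition Einv :: "(nat \<Rightarrow> real) \<Rightarrow> (nat \<Rightarrow> real) \<Rightarrow> nat \<Rightarrow> real" where
  "Einv lam z n = (fibo (n + 1))\<^sup>2 *
     (\<Sum>j=0..n. (lam j * z j - prev lam j * prev z j) / ((lam j - prev lam j) * fibo j * fibo (j + 1)))"

lemma prev_less:
  assumes "strict_mono lam" and "\<And>k. 0 < lam k"
  shows "prev lam k < lam k"
  using assms by (cases k) (auto simp: strict_mono_def)

text \<open>This makes every sequence available as some \<open>E lam x\<close>. Membership, norm and
  convergence are all read off from \<open>E lam x\<close>, so a vector can be prescribed through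
  its image.\<close>

lemma E_Einv:
  assumes "strict_mono lam" and pos: "\<And>k. 0 < lam k"
  shows "E lam (Einv lam z) = z"
proof
  fix n
  have gap: "lam k - prev lam k > 0" for k
    using prev_less[OF assms, of k] by simp
  \<comment> \<open>The summands of \<open>E\<close> become increments of
    \<open>lam k * z k\<close>, so their sum telescopes.\<close>
  have term_eq: "(lam k - prev lam k) *
      (fibo k / fibo (k + 1) * Einv lam z k - fibo (k + 1) / fibo k * prev (Einv lam z) k)
      = lam k * z k - prev lam k * prev z k" for k
  proof (cases k)
    case 0
    then show ?thesis
      using gap[of 0] by (simp add: Einv_def fibo_def)
  next
    case (Suc i)
    define S where "S = (\<Sum>j=0..i. (lam j * z j - prev lam j * prev z j)
        / ((lam j - prev lam j) * fibo j * fibo (j + 1)))"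
    have k: "Einv lam z k = (fibo (k + 1))\<^sup>2 * (S + (lam k * z k - prev lam k * prev z k)
        / ((lam k - prev lam k) * fibo k * fibo (k + 1)))"
      unfolding Einv_def Suc S_def by simp
    have i: "prev (Einv lam z) k = (fibo k)\<^sup>2 * S"
      unfolding Suc by (simp add: Einv_def S_def)
    \<comment> \<open>With f = f_k and g = f_{k+1}, both coefficients of \<open>S\<close> equal f g,
      so the earlier increments cancel and only the newest one remains.\<close>
    have *: "f \<noteq> 0 \<Longrightarrow> g \<noteq> 0 \<Longrightarrow> d \<noteq> 0 \<Longrightarrow>
        d * (f / g * (g\<^sup>2 * (S + t / (d * f * g))) - g / f * (f\<^sup>2 * S)) = t" for f g d t :: real
      by (simp add: field_simps power2_eq_square)
    show ?thesis
      unfolding k i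
      by (rule *) (use gap[of k] fibo_pos[of k] fibo_pos[of "k+1"] in linarith)+
  qed
  have "(\<Sum>k=0..n. lam k * z k - prev lam k * prev z k) = lam n * z n"
    by (induction n) auto
  then show "E lam (Einv lam z) n = z n"
    unfolding E_def term_eq using pos[of n] by simp
qed

text \<open>For a unit vector the numerators in \<open>Einv\<close> vanish except for
  \<open>lam k\<close> at index \<open>k\<close> and \<open>- lam k\<close> at \<open>k + 1\<close>.
  These are the two fractions in the definition of \<open>basis_seq\<close>; the second enters only
  for n > k.\<close>

lemma basis_seq_eq_Einv: "basis_seq lam k = Einv lam (indicator {k})"
proof
  fix n
  define g where "g j = 1 / ((lam j - prev lam j) * fibo j * fibo (j + 1))" for j
  have split: "(lam j * indicator {k} j - prev lam j * prev (indicator {k}) j)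
      / ((lam j - prev lam j) * fibo j * fibo (j + 1))
    = (if j = k then lam k * g k else 0) - (if j = Suc k then lam k * g (Suc k) else 0)" for j
    by (cases j) (auto simp: g_def)
  show "basis_seq lam k n = Einv lam (indicator {k}) n"
    unfolding Einv_def split sum_subtractf
    by (auto simp: basis_seq_def g_def algebra_simps)
qed

lemma E_basis_seq:
  assumes "strict_mono lam" and "\<And>k. 0 < lam k"
  shows "E lam (basis_seq lam k) = indicator {k}"
  unfolding basis_seq_eq_Einv by (rule E_Einv[OF assms])

text \<open>This transfers expansions in \<open>basis_seq\<close> to approximation of
  \<open>E lam x\<close> by truncations of \<alpha>.\<close>

lemma E_diff_basis_sum:
  assumes "strict_mono lam" and "\<And>k. 0 < lam k"
  shows "E lam (\<lambda>j. x j - (\<Sum>n=0..m. \<alpha> n * basis_seq lam n j)) =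
    (\<lambda>i. E lam x i - (if i \<le> m then \<alpha> i else 0))"
  unfolding E_diff_sum E_basis_seq[OF assms]
  by (auto simp: indicator_def)

section \<open>Approximation by truncations in l_p\<close>

lemma ell_diff_finite:
  assumes "z \<in> ell p"
  shows "(\<lambda>i. z i - (if i \<le> m then \<alpha> i else 0)) \<in> ell p"
proof -
  have "eventually (\<lambda>i. \<bar>z i - (if i \<le> m then \<alpha> i else 0)\<bar> powr p = \<bar>z i\<bar> powr p) sequentially"
    using eventually_gt_at_top[of m] by eventually_elim auto
  then show ?thesis
    using assms summable_cong unfolding ell_def by fastforce
qed

text \<open>The p-th power of this norm is a tail of a convergent series.\<close>

lemma ell_norm_tail:
  assumes "z \<in> ell p" and "0 < p"
  shows "(\<lambda>m. ell_norm p (\<lambda>i. z i - (if i \<le> m then z i else 0))) \<longlonglongrightarrow> 0"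
proof -
  have sm: "summable (\<lambda>i. \<bar>z i\<bar> powr p)"
    using assms by (simp add: ell_def)
  have "(\<Sum>i. \<bar>z i - (if i \<le> m then z i else 0)\<bar> powr p) =
      (\<Sum>i. \<bar>z i\<bar> powr p) - (\<Sum>i\<le>m. \<bar>z i\<bar> powr p)" for m
  proof -
    have "(\<lambda>i. \<bar>z i\<bar> powr p - (if i \<in> {..m} then \<bar>z i\<bar> powr p else 0)) sums
        ((\<Sum>i. \<bar>z i\<bar> powr p) - (\<Sum>i\<le>m. \<bar>z i\<bar> powr p))"
      by (intro sums_diff summable_sums sm sums_If_finite_set) auto
    also have "(\<lambda>i. \<bar>z i\<bar> powr p - (if i \<in> {..m} then \<bar>z i\<bar> powr p else 0)) =
        (\<lambda>i. \<bar>z i - (if i \<le> m then z i else 0)\<bar> powr p)"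
      by auto
    finally show ?thesis by (simp add: sums_iff)
  qed
  moreover have "(\<lambda>m. (\<Sum>i. \<bar>z i\<bar> powr p) - (\<Sum>i\<le>m. \<bar>z i\<bar> powr p)) \<longlonglongrightarrow> 0"
    using tendsto_diff[OF tendsto_const summable_LIMSEQ'[OF sm], of "\<Sum>i. \<bar>z i\<bar> powr p"] by simp
  ultimately have lim: "(\<lambda>m. \<Sum>i. \<bar>z i - (if i \<le> m then z i else 0)\<bar> powr p) \<longlonglongrightarrow> 0"
    by simp
  \<comment> \<open>Nonnegativity of the sums lets the null limit pass through \<open>powr\<close>
    with the positive exponent \<open>1 / p\<close>.\<close>
  have "0 \<le> (\<Sum>i. \<bar>z i - (if i \<le> m then z i else 0)\<bar> powr p)" for m
    using ell_diff_finite[OF assms(1), of m z] by (intro suminf_nonneg) (auto simp: ell_def)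
  then show ?thesis
    unfolding ell_norm_def
    by (intro tendsto_zero_powrI[OF lim tendsto_const]) (use assms in auto)
qed

lemma abs_le_ell_norm:
  assumes "z \<in> ell p" and "0 < p"
  shows "\<bar>z i\<bar> \<le> ell_norm p z"
proof -
  have sm: "summable (\<lambda>i. \<bar>z i\<bar> powr p)"
    using assms by (simp add: ell_def)
  have "\<bar>z i\<bar> powr p \<le> (\<Sum>i. \<bar>z i\<bar> powr p)"
    using sum_le_suminf[OF sm, of "{i}"] by simp
  then have "(\<bar>z i\<bar> powr p) powr (1 / p) \<le> ell_norm p z"
    unfolding ell_norm_def using assms by (intro powr_mono2) auto
  then show ?thesis
    using assms by (simp add: powr_powr)
qed

text \<open>Coordinate \<open>i\<close> of the error stays at \<open>z i - \<alpha> i\<close> once m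
  reaches \<open>i\<close>, and the norm dominates each coordinate, so this constant must be
  0.\<close>

lemma ell_norm_finite_approx_unique:
  assumes z: "z \<in> ell p" and p: "0 < p"
    and lim: "(\<lambda>m. ell_norm p (\<lambda>i. z i - (if i \<le> m then \<alpha> i else 0))) \<longlonglongrightarrow> 0"
  shows "\<alpha> = z"
proof
  fix i
  have "eventually (\<lambda>m. \<bar>z i - \<alpha> i\<bar> \<le> ell_norm p (\<lambda>i. z i - (if i \<le> m then \<alpha> i else 0))) sequentially"
    using eventually_ge_at_top[of i]
  proof eventually_elim
    case (elim m)
    then show ?case
      using abs_le_ell_norm[OF ell_diff_finite[OF z, of m \<alpha>] p, of i] by simp
  qed
  then have "\<bar>z i - \<alpha> i\<bar> \<le> 0"
    by (intro tendsto_le[OF _ lim tendsto_const]) auto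
  then show "\<alpha> i = z i" by simp
qed

section \<open>No countable family has dense span in the bounded sequences\<close>

lemma rational_combination_close:
  fixes c :: "nat \<Rightarrow> nat \<Rightarrow> real"
  assumes bdd: "\<And>n. bounded (range (c n))" and "0 < \<epsilon>"
  shows "\<exists>qs :: rat list. \<forall>j. \<bar>(\<Sum>n=0..m. \<alpha> n * c n j) - (\<Sum>n<length qs. of_rat (qs ! n) * c n j)\<bar> \<le> \<epsilon>"
proof -
  have "\<forall>n. \<exists>M>0. \<forall>j. \<bar>c n j\<bar> \<le> M"
    using bdd by (auto simp: bounded_pos)
  then obtain M where M: "\<And>n. 0 < M n" "\<And>n j. \<bar>c n j\<bar> \<le> M n"
    by metis
  \<comment> \<open>Each of the m + 1 terms may contribute an error of \<epsilon> / (m + 1),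
    uniformly in \<open>j\<close> because \<open>M n\<close> bounds the whole row.\<close>
  define \<delta> where "\<delta> n = \<epsilon> / (real (Suc m) * M n)" for n
  have "\<exists>q :: rat. \<bar>\<alpha> n - of_rat q\<bar> \<le> \<delta> n" for n
  proof -
    have "\<alpha> n < \<alpha> n + \<delta> n"
      using M(1)[of n] \<open>0 < \<epsilon>\<close> by (simp add: \<delta>_def)
    from of_rat_dense[OF this] show ?thesis
      by (metis abs_le_iff add.commute diff_le_eq less_imp_le minus_diff_eq
          abs_of_pos abs_minus_commute diff_gt_0_iff_gt)
  qed
  then obtain q :: "nat \<Rightarrow> rat" where q: "\<And>n. \<bar>\<alpha> n - of_rat (q n)\<bar> \<le> \<delta> n"
    by metis
  define qs where "qs = map q [0..<Suc m]"
  have "\<bar>(\<Sum>n=0..m. \<alpha> n * c n j) - (\<Sum>n<length qs. of_rat (qs ! n) * c n j)\<bar> \<le> \<epsilon>" for j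
  proof -
    have "(\<Sum>n<length qs. of_rat (qs ! n) * c n j) = (\<Sum>n=0..m. of_rat (q n) * c n j)"
      by (rule sum.cong) (auto simp: qs_def nth_append less_Suc_eq_le simp del: upt_Suc)
    then have "\<bar>(\<Sum>n=0..m. \<alpha> n * c n j) - (\<Sum>n<length qs. of_rat (qs ! n) * c n j)\<bar>
        = \<bar>\<Sum>n=0..m. (\<alpha> n - of_rat (q n)) * c n j\<bar>"
      by (simp add: sum_subtractf left_diff_distrib)
    also have "\<dots> \<le> (\<Sum>n=0..m. \<bar>\<alpha> n - of_rat (q n)\<bar> * \<bar>c n j\<bar>)"
      using sum_abs[of "\<lambda>n. (\<alpha> n - of_rat (q n)) * c n j" "{0..m}"] by (simp add: abs_mult)
    also have "\<dots> \<le> (\<Sum>n=0..m. \<delta> n * M n)"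
      using q M by (intro sum_mono mult_mono) (auto intro: order_trans[OF abs_ge_zero])
    also have "\<dots> = (\<Sum>n=0..m. \<epsilon> / real (Suc m))"
      using M(1) by (intro sum.cong) (auto simp: \<delta>_def less_imp_neq[symmetric])
    also have "\<dots> = \<epsilon>"
      by simp
    finally show ?thesis .
  qed
  then show ?thesis by blast
qed

text \<open>Rational coefficient lists form a countable type, so each list has a code
  \<open>to_nat qs\<close>, and one set \<open>A\<close> can be chosen to disagree with every
  rational combination at the code of its own list.\<close>

lemma indicator_not_near_countable_span:
  fixes c :: "nat \<Rightarrow> nat \<Rightarrow> real"
  assumes "\<And>n. bounded (range (c n))"
  shows "\<exists>A :: nat set. \<forall>m \<alpha>. \<exists>j. \<bar>indicator A j - (\<Sum>n=0..m. \<alpha> n * c n j)\<bar> \<ge> 1 / 4"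
proof -
  define g :: "rat list \<Rightarrow> nat \<Rightarrow> real"
    where "g qs j = (\<Sum>n<length qs. of_rat (qs ! n) * c n j)" for qs j
  \<comment> \<open>Membership of n is decided against the combination coded by n: if its value at n
    is at most 1/2 the indicator is 1, otherwise 0, so the gap is at least 1/2 either way.\<close>
  define A where "A = {n. g (from_nat n) n \<le> 1 / 2}"
  have diag: "\<bar>indicator A (to_nat qs) - g qs (to_nat qs)\<bar> \<ge> 1 / 2" for qs
    by (auto simp: A_def indicator_def)
  have "\<exists>j. \<bar>indicator A j - (\<Sum>n=0..m. \<alpha> n * c n j)\<bar> \<ge> 1 / 4" for m \<alpha>
  proof -
    obtain qs where "\<And>j. \<bar>(\<Sum>n=0..m. \<alpha> n * c n j) - g qs j\<bar> \<le> 1 / 4"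
      \<comment> \<open>Rounding the coefficients costs at most 1/4 of the gap 1/2, which leaves 1/4
        for real coefficients.\<close>
      using rational_combination_close[of c "1 / 4" \<alpha> m, OF assms] by (auto simp: g_def)
    from this[of "to_nat qs"] diag[of qs] show ?thesis
      by (intro exI[of _ "to_nat qs"]) linarith
  qed
  then show ?thesis by blast
qed

lemma bounded_range_diff_sum:
  fixes z :: "nat \<Rightarrow> real" and m :: nat
  assumes "bounded (range z)" and "\<And>n. bounded (range (c n))"
  shows "bounded (range (\<lambda>j. z j - (\<Sum>n=0..m. \<alpha> n * c n j)))"
proof -
  have scaled: "bounded (range (\<lambda>j. \<alpha> n * c n j))" for n
    using bounded_scaling[OF assms(2)[of n], where c = "\<alpha> n"] by (simp add: image_image)
  have "bounded (range (\<lambda>j. \<Sum>n=0..m. \<alpha> n * c n j))"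
    by (induction m) (use scaled in \<open>auto intro!: bounded_plus_comp\<close>)
  then show ?thesis
    by (rule bounded_minus_comp[OF assms(1)])
qed

lemma ellF_inf_no_schauder_basis:
  assumes "strict_mono lam" and "\<And>k. 0 < lam k"
  shows "\<not> schauder_basis (ellF_inf lam) (ellF_inf_norm lam) b"
proof
  assume b: "schauder_basis (ellF_inf lam) (ellF_inf_norm lam) b"
  define c where "c n = E lam (b n)" for n
  have c: "bounded (range (c n))" for n
    using b by (auto simp: schauder_basis_def ellF_inf_def ell_inf_def c_def)
  obtain A :: "nat set"
    where A: "\<And>m \<alpha>. \<exists>j. \<bar>indicator A j - (\<Sum>n=0..m. \<alpha> n * c n j)\<bar> \<ge> 1 / 4"
    using indicator_not_near_countable_span[of c, OF c] by blast
  \<comment> \<open>The bad indicator is pulled back to a vector of the space, whose expansion in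
    \<open>b\<close> would approximate it uniformly.\<close>
  define x where "x = Einv lam (indicator A)"
  have Ex: "E lam x = indicator A"
    unfolding x_def by (rule E_Einv[OF assms])
  have bdd: "bounded (range (indicator A :: nat \<Rightarrow> real))"
    by (rule boundedI[of _ 1]) (auto simp: indicator_def)
  then have "x \<in> ellF_inf lam"
    by (simp add: ellF_inf_def ell_inf_def Ex)
  then obtain \<alpha> where "expands (ellF_inf_norm lam) b x \<alpha>"
    using b unfolding schauder_basis_def by blast
  then have "(\<lambda>m. SUP j. \<bar>indicator A j - (\<Sum>n=0..m. \<alpha> n * c n j)\<bar>) \<longlonglongrightarrow> 0"
    by (simp add: expands_def ellF_inf_norm_def ell_inf_norm_def E_diff_sum Ex c_def)
  then have "eventually (\<lambda>m. (SUP j. \<bar>indicator A j - (\<Sum>n=0..m. \<alpha> n * c n j)\<bar>) < 1 / 4) sequentially"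
    by (rule order_tendstoD) simp
  then obtain m where m: "(SUP j. \<bar>indicator A j - (\<Sum>n=0..m. \<alpha> n * c n j)\<bar>) < 1 / 4"
    by (auto simp: eventually_sequentially)
  \<comment> \<open>Boundedness ensures that the real \<open>SUP\<close> really dominates each
    coordinate.\<close>
  have "bdd_above (range (\<lambda>j. \<bar>indicator A j - (\<Sum>n=0..m. \<alpha> n * c n j)\<bar>))"
    using bounded_range_diff_sum[of _ c, OF bdd c, where m = m and \<alpha> = \<alpha>]
    by (simp add: bounded_imp_bdd_above bounded_norm_comp flip: real_norm_def)
  then have "\<bar>indicator A j - (\<Sum>n=0..m. \<alpha> n * c n j)\<bar> < 1 / 4" for j
    using m by (meson UNIV_I cSUP_upper le_less_trans)
  then show False
    using A[of \<alpha> m] by (meson not_less)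
qed

text \<open>Tail convergence gives existence, coordinatewise domination gives uniqueness; as an
  equivalence this settles both the basis property and the formula for the coefficients.\<close>

lemma expands_basis_seq_iff:
  assumes "strict_mono lam" and "\<And>k. 0 < lam k" and "0 < p" and x: "x \<in> ellF lam p"
  shows "expands (ellF_norm lam p) (basis_seq lam) x \<alpha> \<longleftrightarrow> \<alpha> = E lam x"
  using ell_norm_tail[of "E lam x" p] ell_norm_finite_approx_unique[of "E lam x" p \<alpha>] assms
  by (auto simp: expands_def ellF_norm_def E_diff_basis_sum[OF assms(1,2)] ellF_def)

theorem corollary2p12:
  fixes lam :: "nat \<Rightarrow> real" and p :: real
  assumes lam_mono: "strict_mono lam"
    and lam_pos: "\<And>k. 0 < lam k"
    and lam_lim: "filterlim lam at_top sequentially"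
    and p: "1 \<le> p"
  shows "(\<not> (\<exists>b. schauder_basis (ellF_inf lam) (ellF_inf_norm lam) b)) \<and>
    schauder_basis (ellF lam p) (ellF_norm lam p) (basis_seq lam) \<and>
    (\<forall>x \<in> ellF lam p.
       expands (ellF_norm lam p) (basis_seq lam) x (\<lambda>k. E lam x k) \<and>
       (\<forall>\<alpha>. expands (ellF_norm lam p) (basis_seq lam) x \<alpha> \<longrightarrow> \<alpha> = (\<lambda>k. E lam x k)))"
proof -
  have p0: "0 < p" using p by simp
  note iff = expands_basis_seq_iff[OF lam_mono lam_pos p0]
  \<comment> \<open>Unit vectors have finite support, hence lie in l_p; this puts each
    \<open>basis_seq lam k\<close> into the space.\<close>
  have "summable (\<lambda>i. \<bar>indicator {k} i :: real\<bar> powr p)" for k :: nat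
    by (rule summable_finite[of "{k}"]) auto
  then have "basis_seq lam k \<in> ellF lam p" for k
    by (simp add: ellF_def ell_def E_basis_seq[OF lam_mono lam_pos])
  then have "schauder_basis (ellF lam p) (ellF_norm lam p) (basis_seq lam)"
    by (simp add: schauder_basis_def iff)
  then show ?thesis
    using ellF_inf_no_schauder_basis[OF lam_mono lam_pos] by (simp add: iff)
qed

end
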